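(* Let $F$ and $Q$ be disjoint subsets of the set of rational numbers, and equip $Q\cup F$ with the subspace topology inherited from the real line. Suppose that $F$ is infinite and that $F$ has no isolated point in $Q\cup F$, i.e. no point $x\in F$ is an isolated point of the space $Q\cup F$. Then there exists a bijection $f: Q\cup F\to Q\cup F$ such that: (i) $Q$ is exactly the set of points of $Q\cup F$ at which $f$ is continuous; (ii) $f(y)=y$ for every $y\in Q$; (iii) for every $x\in F$ we have $f(x)\neq x$ and $f(f(x))=x$.
   Context: Here $Q$ denotes an arbitrary set of rational numbers disjoint from $F$ (not the set of all rationals); $Q$ may be empty. Continuity of $f$ at a point is with respect to the subspace topology on $Q\cup F$ inherited from $\mathbb{R}$, on both domain and codomain. *)

theory Defs
  imports "HOL-Analysis.Analysis"
begin

end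

theory Submission
  imports Defs
begin

text \<open>
  Measure distances through \<open>arctan\<close>, so that the line becomes bounded, and enumerate \<open>F\<close>. Pair
  greedily: match the first unmatched point with an almost nearest unmatched point. Since an infinite
  bounded set has points arbitrarily close together, the distance within the pairs tends to \<open>0\<close>.
  Let \<open>f\<close> swap each pair and fix \<open>Q\<close>. Then \<open>f x\<close> tends to \<open>a\<close> as \<open>x\<close> tends to \<open>a\<close>, for every real
  \<open>a\<close>. So \<open>f\<close> is continuous at a non-isolated point of \<open>Q \<union> F\<close> exactly if it fixes that point.
\<close>

lemma greedy_sequence:
  fixes h :: "nat \<Rightarrow> 'a::metric_space"
  obtains z w :: "nat \<Rightarrow> nat"
  where "\<And>i j. z i \<noteq> w j" "inj z" "inj w" "range z \<union> range w = UNIV"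
    "\<And>i j. i < j \<Longrightarrow> dist (h (z i)) (h (w i)) \<le> dist (h (z i)) (h (z j)) + inverse (real (Suc i))"
proof -
  \<comment> \<open>\<open>U\<close> stands for the set of indices already paired.\<close>
  define first where "first U = (LEAST n. n \<notin> U)" for U :: "nat set"
  define good where "good n U w \<longleftrightarrow> w \<notin> U \<and> w \<noteq> first U \<and>
      (\<forall>v. v \<notin> U \<longrightarrow> v \<noteq> first U \<longrightarrow>
        dist (h (first U)) (h w) \<le> dist (h (first U)) (h v) + inverse (real (Suc n)))"
    for n U w
  have ex_good: "\<exists>w. good n U w" if "finite U" for n U
  proof -
    define A where "A = (\<lambda>v. dist (h (first U)) (h v)) ` (- U - {first U})"
    have "infinite (- U - {first U})"
      using that by (simp add: Compl_eq_Diff_UNIV)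
    then have "A \<noteq> {}"
      unfolding A_def by (metis finite.emptyI image_is_empty)
    moreover have bdd: "bdd_below A"
      unfolding A_def by (rule bdd_belowI[of _ 0]) auto
    moreover have "Inf A < Inf A + inverse (real (Suc n))"
      by simp
    ultimately obtain d where d: "d \<in> A" "d < Inf A + inverse (real (Suc n))"
      using cInf_less_iff by blast
    then obtain w where w: "w \<notin> U" "w \<noteq> first U" "d = dist (h (first U)) (h w)"
      by (auto simp: A_def)
    have "Inf A \<le> dist (h (first U)) (h v)" if "v \<notin> U" "v \<noteq> first U" for v
      using that bdd by (intro cInf_lower) (auto simp: A_def)
    then have "good n U w"
      using w d(2) unfolding good_def by fastforce
    then show ?thesis ..
  qed
  \<comment> \<open>Dependent choice does not prescribe the initial value, so the invariant itself
    forces the start at \<open>{}\<close>. Finiteness guarantees that a partner exists at every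
    stage.\<close>
  have "\<exists>U. \<forall>n. (finite (U n) \<and> (n = 0 \<longrightarrow> U n = {})) \<and>
      (\<exists>w. good n (U n) w \<and> U (Suc n) = insert (first (U n)) (insert w (U n)))"
  proof (rule dependent_nat_choice[where P = "\<lambda>n U. finite U \<and> (n = 0 \<longrightarrow> U = {})"
        and Q = "\<lambda>n U U'. \<exists>w. good n U w \<and> U' = insert (first U) (insert w U)"])
    show "\<exists>U::nat set. finite U \<and> ((0::nat) = 0 \<longrightarrow> U = {})"
      by (intro exI[of _ "{}"]) simp
    fix U :: "nat set" and n :: nat
    assume "finite U \<and> (n = 0 \<longrightarrow> U = {})"
    moreover from this obtain w where "good n U w"
      using ex_good by blast
    ultimately show "\<exists>U'. (finite U' \<and> (Suc n = 0 \<longrightarrow> U' = {})) \<and>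
        (\<exists>w. good n U w \<and> U' = insert (first U) (insert w U))"
      by (intro exI[of _ "insert (first U) (insert w U)"]) auto
  qed
  then obtain U where fin: "\<And>n. finite (U n)" and U0: "U 0 = {}"
    and ex_w: "\<forall>n. \<exists>w. good n (U n) w \<and> U (Suc n) = insert (first (U n)) (insert w (U n))"
    by blast
  obtain w where good: "\<And>n. good n (U n) (w n)"
    and step: "\<And>n. U (Suc n) = insert (first (U n)) (insert (w n) (U n))"
    using choice[OF ex_w] by blast
  define z where "z n = first (U n)" for n
  have z_notin: "z n \<notin> U n" for n
    unfolding z_def first_def using ex_new_if_finite[OF infinite_UNIV_nat fin]
    by (metis LeastI_ex)
  have w_notin: "w n \<notin> U n" "w n \<noteq> z n" for n
    using good[of n] by (auto simp: good_def z_def)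
  have "mono U"
    using step by (auto simp: mono_iff_le_Suc)
  then have used: "z i \<in> U j" "w i \<in> U j" if "i < j" for i j
    using that step[of i] monoD[of U "Suc i" j] by (auto simp: z_def)
  have "z i \<noteq> w j" for i j
    using used z_notin w_notin by (metis linorder_neqE_nat)
  moreover have "inj z" "inj w"
    using used z_notin w_notin by (auto intro!: linorder_injI) metis+
  moreover have "n \<in> range z \<union> range w" for n
  proof (rule ccontr)
    assume n: "n \<notin> range z \<union> range w"
    have "n \<notin> U k" for k
    proof (induction k)
      case 0
      show ?case by (simp add: U0)
    next
      case (Suc k)
      then show ?case using n step[of k] by (auto simp: z_def)
    qed
    then have "z k \<le> n" for k
      unfolding z_def first_def by (rule Least_le)
    then have "finite (range z)"
      unfolding finite_nat_set_iff_bounded_le by blast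
    then show False
      using \<open>inj z\<close> finite_imageD by blast
  qed
  then have "range z \<union> range w = UNIV"
    by blast
  \<comment> \<open>\<open>z j\<close> is a legitimate competitor of \<open>w i\<close>: it lies
    outside \<open>U j\<close>, hence outside \<open>U i\<close>, and differs from
    \<open>z i\<close>.\<close>
  moreover have "dist (h (z i)) (h (w i)) \<le> dist (h (z i)) (h (z j)) + inverse (real (Suc i))"
    if "i < j" for i j
    using good[of i] used[OF that] z_notin[of j] \<open>inj z\<close> that \<open>mono U\<close>
    unfolding good_def z_def[symmetric] by (metis injD less_imp_le monoD order_less_irrefl subsetD)
  ultimately show thesis
    by (rule that[of z w])
qed

text \<open>Infinitely many pairs at distance at least \<open>e\<close> would, by compactness, have
  first members along a convergent subsequence. Its consecutive members come arbitrarily close,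
  which contradicts the greedy estimate.\<close>

lemma pairing_sequence:
  fixes h :: "nat \<Rightarrow> 'a::heine_borel"
  assumes "bounded (range h)"
  obtains \<sigma> :: "nat \<Rightarrow> nat"
  where "\<And>n. \<sigma> n \<noteq> n" "\<And>n. \<sigma> (\<sigma> n) = n" "\<And>e. e > 0 \<Longrightarrow> finite {n. e \<le> dist (h (\<sigma> n)) (h n)}"
proof -
  obtain z w :: "nat \<Rightarrow> nat" where zw: "\<And>i j. z i \<noteq> w j" "inj z" "inj w" "range z \<union> range w = UNIV"
    and near: "\<And>i j. i < j \<Longrightarrow>
      dist (h (z i)) (h (w i)) \<le> dist (h (z i)) (h (z j)) + inverse (real (Suc i))"
    using greedy_sequence[of h] by metis
  define \<sigma> where "\<sigma> n = (if n \<in> range z then w (inv z n) else z (inv w n))" for n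
  have \<sigma>z: "\<sigma> (z i) = w i" for i
    using zw by (simp add: \<sigma>_def)
  have \<sigma>w: "\<sigma> (w i) = z i" for i
    using zw(1,3) by (auto simp: \<sigma>_def) (metis zw(1))
  have zw_cases: "(\<exists>i. n = z i) \<or> (\<exists>i. n = w i)" for n
    using zw(4) by blast
  have fin: "finite {i. e \<le> dist (h (z i)) (h (w i))}" (is "finite ?I") if "e > 0" for e
  proof (rule ccontr)
    assume inf: "infinite ?I"
    \<comment> \<open>Listing the bad stages in increasing order lets the greedy estimate compare
      each with the next.\<close>
    define r where "r = enumerate ?I"
    have r: "strict_mono r" "r n \<in> ?I" for n
      using inf by (auto simp: r_def strict_mono_enumerate dest: enumerate_in_set)
    have "bounded (range (\<lambda>n. h (z (r n))))"
      using assms by (rule bounded_subset) auto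
    then obtain l s where s: "strict_mono s" "((\<lambda>n. h (z (r n))) \<circ> s) \<longlonglongrightarrow> l"
      using bounded_imp_convergent_subsequence by blast
    then have lim: "(\<lambda>n. h (z (r (s n)))) \<longlonglongrightarrow> l"
      by (simp add: o_def)
    have mono: "strict_mono (\<lambda>n. r (s n))"
      using r s by (simp add: strict_mono_def)
    \<comment> \<open>These greedy bounds for consecutive bad stages tend to 0, yet each is at least
      \<open>e\<close>.\<close>
    have "(\<lambda>n. dist (h (z (r (s n)))) (h (z (r (s (Suc n))))) + inverse (real (Suc (r (s n)))))
        \<longlonglongrightarrow> dist l l + 0"
      using lim LIMSEQ_Suc[OF lim]
        filterlim_compose[OF LIMSEQ_inverse_real_of_nat filterlim_subseq[OF mono]]
      by (intro tendsto_add tendsto_dist)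
    then have "e \<le> dist l l + 0"
    proof (rule LIMSEQ_le_const, intro exI allI impI)
      fix n
      have "r (s n) < r (s (Suc n))"
        using mono by (simp add: strict_mono_def)
      from near[OF this] r(2)[of "s n"]
      show "e \<le> dist (h (z (r (s n)))) (h (z (r (s (Suc n))))) + inverse (real (Suc (r (s n))))"
        by simp
    qed
    then show False
      using that by simp
  qed
  show thesis
  proof (rule that)
    show "\<sigma> n \<noteq> n" "\<sigma> (\<sigma> n) = n" for n
      using zw_cases[of n] \<sigma>z \<sigma>w zw(1) by metis+
    fix e :: real
    assume "e > 0"
    let ?I = "{i. e \<le> dist (h (z i)) (h (w i))}"
    have "{n. e \<le> dist (h (\<sigma> n)) (h n)} \<subseteq> z ` ?I \<union> w ` ?I"
    proof
      fix n
      assume "n \<in> {n. e \<le> dist (h (\<sigma> n)) (h n)}"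
      then show "n \<in> z ` ?I \<union> w ` ?I"
        using zw_cases[of n] by (auto simp: \<sigma>z \<sigma>w dist_commute)
    qed
    then show "finite {n. e \<le> dist (h (\<sigma> n)) (h n)}"
      using fin[OF \<open>e > 0\<close>] finite_subset by blast
  qed
qed

text \<open>The pairing of indices is carried over to \<open>F\<close> along an enumeration.
  Measuring through \<open>g\<close> covers an unbounded \<open>F\<close> with bounded
  image.\<close>

lemma pairing_countable:
  fixes g :: "'a \<Rightarrow> 'b::heine_borel"
  assumes "countable F" "infinite F" "bounded (g ` F)"
  shows "\<exists>p. (\<forall>x\<in>F. p x \<in> F \<and> p x \<noteq> x \<and> p (p x) = x) \<and>
    (\<forall>e>0. finite {x \<in> F. e \<le> dist (g (p x)) (g x)})"
proof -
  define b where "b = from_nat_into F"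
  have b: "bij_betw b UNIV F"
    unfolding b_def using assms by (intro bij_betw_from_nat_into)
  then have inj: "inj b" and range: "range b = F"
    by (auto simp: bij_betw_def)
  obtain \<sigma> where \<sigma>: "\<And>n. \<sigma> n \<noteq> n" "\<And>n. \<sigma> (\<sigma> n) = n"
    and fin: "\<And>e. e > 0 \<Longrightarrow> finite {n. e \<le> dist (g (b (\<sigma> n))) (g (b n))}"
    using pairing_sequence[of "\<lambda>n. g (b n)"] assms(3) unfolding range[symmetric] image_image
    by metis
  define p where "p x = b (\<sigma> (inv b x))" for x
  have pb: "p (b n) = b (\<sigma> n)" for n
    using inj by (simp add: p_def)
  show ?thesis
  proof (intro exI[of _ p] conjI ballI allI impI)
    fix x assume "x \<in> F"
    then obtain n where "x = b n"
      using range by blast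
    then show "p x \<in> F" "p x \<noteq> x" "p (p x) = x"
      using range \<sigma> inj by (auto simp: pb inj_eq)
  next
    fix e :: real assume "e > 0"
    have "{x \<in> F. e \<le> dist (g (p x)) (g x)} \<subseteq> b ` {n. e \<le> dist (g (b (\<sigma> n))) (g (b n))}"
      unfolding range[symmetric] using pb by auto
    then show "finite {x \<in> F. e \<le> dist (g (p x)) (g x)}"
      using fin[OF \<open>e > 0\<close>] finite_surj by blast
  qed
qed

text \<open>Near \<open>a\<close>, apart from \<open>a\<close> itself, the finitely many points
  moved by at least \<open>e\<close> are avoided. So \<open>arctan (p x)\<close> and
  \<open>arctan x\<close> have the same limit, and \<open>tan\<close> undoes
  \<open>arctan\<close>.\<close>

lemma tendsto_of_arctan_near:
  fixes p :: "real \<Rightarrow> real"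
  assumes "\<And>e. e > 0 \<Longrightarrow> finite {x \<in> F. e \<le> dist (arctan (p x)) (arctan x)}"
  shows "(p \<longlongrightarrow> a) (at a within F)"
proof -
  have "((\<lambda>x. dist (arctan (p x)) (arctan x)) \<longlongrightarrow> 0) (at a within F)"
  proof (rule tendstoI)
    fix e :: real assume "e > 0"
    \<comment> \<open>A finite set without \<open>a\<close> is closed, so its complement is an open
      neighbourhood of \<open>a\<close>.\<close>
    let ?B = "{x \<in> F. e \<le> dist (arctan (p x)) (arctan x)} - {a}"
    have "open (- ?B)" "a \<in> - ?B"
      using assms[OF \<open>e > 0\<close>] by (simp_all only: open_Compl finite_imp_closed finite_Diff) simp
    then show "\<forall>\<^sub>F x in at a within F. dist (dist (arctan (p x)) (arctan x)) 0 < e"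
      unfolding eventually_at_topological by (intro exI[of _ "- ?B"]) auto
  qed
  then have "((\<lambda>x. arctan (p x) - arctan x) \<longlongrightarrow> 0) (at a within F)"
    unfolding dist_norm by (rule tendsto_norm_zero_cancel)
  moreover have "((\<lambda>x. arctan x) \<longlongrightarrow> arctan a) (at a within F)"
    by (intro tendsto_intros)
  ultimately have "((\<lambda>x. arctan (p x) - arctan x + arctan x) \<longlongrightarrow> 0 + arctan a) (at a within F)"
    by (rule tendsto_add)
  then have "((\<lambda>x. arctan (p x)) \<longlongrightarrow> arctan a) (at a within F)"
    by simp
  then have "((\<lambda>x. tan (arctan (p x))) \<longlongrightarrow> tan (arctan a)) (at a within F)"
    by (intro tendsto_tan) simp_all
  then show ?thesis
    by (simp add: tan_arctan)
qed

text \<open>This turns continuity between subspaces into a filter limit on the real line, where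
  limits can be compared.\<close>

lemma topcontinuous_at_top_of_set_iff:
  "topcontinuous_at (top_of_set S) (top_of_set T) f x \<longleftrightarrow>
    x \<in> S \<and> f \<in> S \<rightarrow> T \<and> (f \<longlongrightarrow> f x) (at x within S)"
proof -
  have "atin_within euclidean x S = at x within S"
    by (simp add: filter_eq_iff eventually_atin_within eventually_at_topological) meson
  then show ?thesis
    by (auto simp: topcontinuous_at_atin limitin_subtopology atin_subtopology_within Pi_iff
        eventually_at_filter)
qed

theorem theorem1:
  fixes F Q :: "real set"
  assumes "F \<subseteq> \<rat>" and "Q \<subseteq> \<rat>" and "F \<inter> Q = {}"
    and "infinite F"
    and "\<forall>x\<in>F. \<not> x isolated_in (Q \<union> F)"
  shows "\<exists>f :: real \<Rightarrow> real.
           bij_betw f (Q \<union> F) (Q \<union> F) \<and>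
           {x \<in> Q \<union> F. topcontinuous_at (top_of_set (Q \<union> F)) (top_of_set (Q \<union> F)) f x} = Q \<and>
           (\<forall>y\<in>Q. f y = y) \<and>
           (\<forall>x\<in>F. f x \<noteq> x \<and> f (f x) = x)"
proof -
  have F: "countable F"
    using assms(1) countable_rat countable_subset by blast
  have bdd: "bounded (arctan ` F)"
  proof (rule bounded_subset)
    show "arctan ` F \<subseteq> {- (pi/2)<..<pi/2}"
      using arctan_lbound arctan_ubound greaterThanLessThan_iff by blast
  qed simp
  from pairing_countable[OF F assms(4) bdd]
  obtain p where *: "(\<forall>x\<in>F. p x \<in> F \<and> p x \<noteq> x \<and> p (p x) = x) \<and>
      (\<forall>e>0. finite {x \<in> F. e \<le> dist (arctan (p x)) (arctan x)})"
    by (rule exE)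
  have p: "p x \<in> F" "p x \<noteq> x" "p (p x) = x" if "x \<in> F" for x
    using * that by simp_all
  have fin: "finite {x \<in> F. e \<le> dist (arctan (p x)) (arctan x)}" if "e > 0" for e
    using * that by simp
  define f where "f x = (if x \<in> F then p x else x)" for x
  have fF: "f x = p x" if "x \<in> F" for x
    using that by (simp add: f_def)
  have fQ: "f y = y" if "y \<in> Q" for y
    using that assms(3) by (auto simp: f_def)
  have maps: "f x \<in> Q \<union> F" "f (f x) = x" if "x \<in> Q \<union> F" for x
    using that p fF fQ by auto
  \<comment> \<open>An involution is its own inverse.\<close>
  then have "bij_betw f (Q \<union> F) (Q \<union> F)"
    by (intro bij_betw_byWitness[where f' = f]) auto
  \<comment> \<open>The limit is taken separately along \<open>Q\<close>, where \<open>f\<close> is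
    the identity, and along \<open>F\<close>, where it is the pairing.\<close>
  moreover have lim: "(f \<longlongrightarrow> a) (at a within (Q \<union> F))" for a
  proof (rule Lim_Un)
    show "(f \<longlongrightarrow> a) (at a within Q)"
      using tendsto_ident_at
      by (rule Lim_transform_eventually) (auto simp: eventually_at_filter fQ)
    show "(f \<longlongrightarrow> a) (at a within F)"
      using tendsto_of_arctan_near[OF fin]
      by (rule Lim_transform_eventually) (auto simp: eventually_at_filter fF)
  qed
  have not_lim: "\<not> (f \<longlongrightarrow> f x) (at x within (Q \<union> F))" if "x \<in> F" for x
  proof -
    \<comment> \<open>Non-isolation makes the limit at \<open>x\<close> unique: it is
      \<open>x\<close>, whereas \<open>f x = p x\<close> differs from \<open>x\<close>.\<close>
    have "x islimpt (Q \<union> F)"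
      using assms(5) that by (auto simp: isolated_in_islimpt_iff)
    then show ?thesis
      using tendsto_unique[OF _ lim[of x]] p(2)[OF that] fF[OF that]
      by (metis trivial_limit_within)
  qed
  have "{x \<in> Q \<union> F. topcontinuous_at (top_of_set (Q \<union> F)) (top_of_set (Q \<union> F)) f x} = Q"
    unfolding topcontinuous_at_top_of_set_iff
  proof (intro set_eqI iffI)
    fix x assume "x \<in> Q"
    then show "x \<in> {x \<in> Q \<union> F. x \<in> Q \<union> F \<and> f \<in> Q \<union> F \<rightarrow> Q \<union> F \<and> (f \<longlongrightarrow> f x) (at x within (Q \<union> F))}"
      using lim[of x] maps(1) by (simp add: fQ)
  qed (use not_lim in blast)
  ultimately show ?thesis
    by (intro exI[of _ f] conjI ballI; (assumption | simp add: fQ fF p))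
qed

end
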